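(* Let $\mathcal{F}_{\Delta t}:\mathbb{R}^{4d}\to\mathbb{R}^{4d}$ be (the one-step map of) an extended phase space scheme for the extended stochastic Hamiltonian system, and let $\widetilde{\mathcal{F}}_{\Delta t}:(X^n,Y^n)\mapsto(X^{n+1},Y^{n+1})$ be the associated stochastic semi-explicit scheme obtained from $\mathcal{F}_{\Delta t}$ by symmetric projection. If the extended phase space scheme $\widetilde\xi^{n+1}=\mathcal{F}_{\Delta t}(\widetilde\xi^{n})$, $\widetilde\xi^n=((\widetilde X^n)^\top,(\widetilde U^n)^\top,(\widetilde Y^n)^\top,(\widetilde V^n)^\top)^\top$, is symplectic, i.e. almost surely $$\mathrm{d}\widetilde X^{n+1}\wedge \mathrm{d}\widetilde Y^{n+1}+\mathrm{d}\widetilde U^{n+1}\wedge \mathrm{d}\widetilde V^{n+1}=\mathrm{d}\widetilde X^{n}\wedge \mathrm{d}\widetilde Y^{n}+\mathrm{d}\widetilde U^{n}\wedge \mathrm{d}\widetilde V^{n},$$ then the stochastic semi-explicit scheme based on $\widetilde{\mathcal{F}}_{\Delta t}$ preserves the symplectic structure almost surely, i.e. $$\mathrm{d}X^{n+1}\wedge \mathrm{d}Y^{n+1}=\mathrm{d}X^{n}\wedge \mathrm{d}Y^{n}\quad\text{a.s.},\qquad n\in\{0,1,\ldots,N-1\}.$$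
   Context: **Original system.** Let $H_0,\dots,H_m\in C^\infty(\mathbb{R}^{2d},\mathbb{R})$, let $W_1,\dots,W_m$ be independent standard Wiener processes, and write $dW_0(t):=dt$. The stochastic Hamiltonian system (Stratonovich sense) is $$dX=\sum_{r=0}^m\frac{\partial H_r(X,Y)}{\partial Y}\circ dW_r,\qquad dY=-\sum_{r=0}^m\frac{\partial H_r(X,Y)}{\partial X}\circ dW_r,\qquad X(0)=x^0,\ Y(0)=y^0\in\mathbb{R}^d,\ t\in(0,T].$$ **Extended system.** With constants $\gamma_r\in\mathbb{R}$ and augmented Hamiltonians $\tilde H_r(X,U,Y,V)=H_r(X,V)+H_r(U,Y)+\gamma_r\|X-U\|^2+\gamma_r\|Y-V\|^2$, $r=0,\dots,m$, the extended system on $\mathbb{R}^{4d}$ is the stochastic Hamiltonian system $$dX=\sum_{r}\tfrac{\partial\tilde H_r}{\partial Y}\circ dW_r,\quad dU=\sum_r\tfrac{\partial\tilde H_r}{\partial V}\circ dW_r,\quad dY=-\sum_r\tfrac{\partial\tilde H_r}{\partial X}\circ dW_r,\quad dV=-\sum_r\tfrac{\partial\tilde H_r}{\partial U}\circ dW_r,$$ with symplectic form $\mathrm{d}X\wedge \mathrm{d}Y+\mathrm{d}U\wedge \mathrm{d}V$. Points of $\mathbb{R}^{4d}$ are ordered as $(X,U,Y,V)$. An extended phase space scheme is a one-step method $\mathcal{F}_{\Delta t}$ for this system; it is a smooth map of $\mathbb{R}^{4d}$ for each realization of the noise, and is the identity for $\Delta t=0$. **Time grid.** $\Delta t=T/N$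 is the time step, $t_n=n\Delta t$. **Semi-explicit scheme (symmetric projection).** Let $$A=\begin{bmatrix}I_d&-I_d&0&0\\0&0&I_d&-I_d\end{bmatrix}\in\mathbb{R}^{2d\times4d},\qquad \mathcal N:=\ker A .$$ Given $(X^n,Y^n)$, set $\xi^n:=((X^n)^\top,(X^n)^\top,(Y^n)^\top,(Y^n)^\top)^\top\in\mathcal N$ and $\widetilde\xi^n:=\xi^n+A^\top\lambda$, where $\lambda\in\mathbb{R}^{2d}$ is determined by requiring $$\xi^{n+1}:=\mathcal{F}_{\Delta t}(\xi^n+A^\top\lambda)+A^\top\lambda\in\mathcal N .$$ Put $\widetilde\xi^{n+1}:=\mathcal F_{\Delta t}(\widetilde\xi^n)$. Since $\xi^{n+1}\in\mathcal N$, it has the form $\xi^{n+1}=((X^{n+1})^\top,(X^{n+1})^\top,(Y^{n+1})^\top,(Y^{n+1})^\top)^\top$, and this defines $\widetilde{\mathcal F}_{\Delta t}(X^n,Y^n):=(X^{n+1},Y^{n+1})$. As in the construction by the implicit function theorem, it is understood that $\Delta t$ is small enough that this equation has its local solution $\lambda$ near $0$, depending smoothly on $\xi^n$. **Notation.** $\mathrm{d}$ denotes the exterior differential in phase space (with respect to the initial value), for fixed realization of the noise; for $\mathbb{R}^d$-valued functions $u,v$, $\mathrm{d}u\wedge \mathrm{d}v:=\sum_{i=1}^d \mathrm{d}u_i\wedge \mathrm{d}v_i$. *)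

theory Defs
  imports "HOL-Probability.Probability"
begin

text \<open>Points \<open>(X, Y)\<close> of the \<open>2d\<close>-dimensional and \<open>(X, U, Y, V)\<close> of the \<open>4d\<close>-dimensional phase space,
  with \<open>d = CARD('d)\<close>.\<close>

type_synonym 'd phase = "(real^'d) \<times> (real^'d)"
type_synonym 'd ext_phase = "(real^'d) \<times> (real^'d) \<times> (real^'d) \<times> (real^'d)"


section \<open>Smooth maps\<close>

text \<open>\<open>k_times_differentiable_on k S f\<close> says that all iterated directional derivatives of \<open>f\<close> up to
  order \<open>k\<close> exist on \<open>S\<close> as values of Frechet derivatives and are continuous; for open \<open>S\<close> this is
  \<open>C\<^sup>k\<close> on \<open>S\<close>.\<close>

primrec k_times_differentiable_on ::
  "nat \<Rightarrow> 'a::real_normed_vector set \<Rightarrow> ('a \<Rightarrow> 'b::real_normed_vector) \<Rightarrow> bool"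
where
  "k_times_differentiable_on 0 S f \<longleftrightarrow> continuous_on S f"
| "k_times_differentiable_on (Suc k) S f \<longleftrightarrow>
     (\<forall>x\<in>S. f differentiable (at x)) \<and>
     (\<forall>v. k_times_differentiable_on k S (\<lambda>x. frechet_derivative f (at x) v))"

definition smooth_on :: "'a::real_normed_vector set \<Rightarrow> ('a \<Rightarrow> 'b::real_normed_vector) \<Rightarrow> bool" where
  "smooth_on S f \<longleftrightarrow> (\<forall>k. k_times_differentiable_on k S f)"


section \<open>Differential forms\<close>

definition ext_d :: "('a::real_normed_vector \<Rightarrow> real) \<Rightarrow> 'a \<Rightarrow> 'a \<Rightarrow> real" where
  "ext_d f z = frechet_derivative f (at z)"

definition wedge :: "('a \<Rightarrow> real) \<Rightarrow> ('a \<Rightarrow> real) \<Rightarrow> 'a \<Rightarrow> 'a \<Rightarrow> real" where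
  "wedge \<alpha> \<beta> = (\<lambda>a b. \<alpha> a * \<beta> b - \<alpha> b * \<beta> a)"

text \<open>The 2-form \<open>du \<and> dv = (\<Sum>i. du\<^sub>i \<and> dv\<^sub>i)\<close> at the point \<open>z\<close>.\<close>

definition dwedge ::
  "('a::real_normed_vector \<Rightarrow> real^'d) \<Rightarrow> ('a \<Rightarrow> real^'d) \<Rightarrow> 'a \<Rightarrow> 'a \<Rightarrow> 'a \<Rightarrow> real"
where
  "dwedge u v z = (\<lambda>a b. \<Sum>i\<in>UNIV. wedge (ext_d (\<lambda>x. u x $ i) z) (ext_d (\<lambda>x. v x $ i) z) a b)"

text \<open>\<open>dX \<and> dY\<close> for a phase-space valued function \<open>f = (X, Y)\<close>, and \<open>dX \<and> dY + dU \<and> dV\<close> for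
  \<open>f = (X, U, Y, V)\<close>.\<close>

definition sform :: "('a::real_normed_vector \<Rightarrow> 'd::finite phase) \<Rightarrow> 'a \<Rightarrow> 'a \<Rightarrow> 'a \<Rightarrow> real" where
  "sform f z = dwedge (\<lambda>x. fst (f x)) (\<lambda>x. snd (f x)) z"

definition ext_sform ::
  "('a::real_normed_vector \<Rightarrow> 'd::finite ext_phase) \<Rightarrow> 'a \<Rightarrow> 'a \<Rightarrow> 'a \<Rightarrow> real"
where
  "ext_sform f z = (\<lambda>a b.
     dwedge (\<lambda>x. case f x of (X, U, Y, V) \<Rightarrow> X) (\<lambda>x. case f x of (X, U, Y, V) \<Rightarrow> Y) z a b +
     dwedge (\<lambda>x. case f x of (X, U, Y, V) \<Rightarrow> U) (\<lambda>x. case f x of (X, U, Y, V) \<Rightarrow> V) z a b)"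


section \<open>The driving noise\<close>

definition standard_wiener :: "'w measure \<Rightarrow> (real \<Rightarrow> 'w \<Rightarrow> real) \<Rightarrow> bool" where
  "standard_wiener M B \<longleftrightarrow>
     (\<forall>t\<ge>0. B t \<in> borel_measurable M) \<and>
     (AE \<omega> in M. B 0 \<omega> = 0) \<and>
     (AE \<omega> in M. continuous_on {0..} (\<lambda>t. B t \<omega>)) \<and>
     (\<forall>s t. 0 \<le> s \<and> s < t \<longrightarrow>
        distributed M lborel (\<lambda>\<omega>. B t \<omega> - B s \<omega>) (normal_density 0 (sqrt (t - s)))) \<and>
     (\<forall>(p :: nat \<Rightarrow> real) k. 0 \<le> p 0 \<and> mono p \<longrightarrow>
        prob_space.indep_vars M (\<lambda>_. borel) (\<lambda>i \<omega>. B (p (Suc i)) \<omega> - B (p i) \<omega>) {..<k})"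

definition independent_wieners :: "'w measure \<Rightarrow> nat \<Rightarrow> (nat \<Rightarrow> real \<Rightarrow> 'w \<Rightarrow> real) \<Rightarrow> bool" where
  "independent_wieners M m W \<longleftrightarrow>
     (\<forall>r\<in>{1..m}. standard_wiener M (W r)) \<and>
     prob_space.indep_vars M (\<lambda>_. Pi\<^sub>M {0..} (\<lambda>_. borel)) (\<lambda>r \<omega>. \<lambda>t\<in>{0..}. W r t \<omega>) {1..m}"

text \<open>The convention \<open>dW\<^sub>0 = dt\<close>: the value of \<open>W 0\<close> itself is never used.\<close>

definition driver :: "(nat \<Rightarrow> real \<Rightarrow> 'w \<Rightarrow> real) \<Rightarrow> nat \<Rightarrow> real \<Rightarrow> 'w \<Rightarrow> real" where
  "driver W r t \<omega> = (if r = 0 then t else W r t \<omega>)"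

text \<open>The increments of the drivers over \<open>[s, s + h]\<close>, as paths on \<open>[0, h]\<close> starting at \<open>0\<close>.\<close>

definition step_noise ::
  "nat \<Rightarrow> (nat \<Rightarrow> real \<Rightarrow> 'w \<Rightarrow> real) \<Rightarrow> real \<Rightarrow> real \<Rightarrow> 'w \<Rightarrow> nat \<Rightarrow> real \<Rightarrow> real"
where
  "step_noise m W s h \<omega> =
     (\<lambda>r\<in>{0..m}. \<lambda>\<tau>\<in>{0..h}. driver W r (s + \<tau>) \<omega> - driver W r s \<omega>)"


section \<open>Extended phase space schemes\<close>

definition aug_H ::
  "(nat \<Rightarrow> 'd::finite phase \<Rightarrow> real) \<Rightarrow> (nat \<Rightarrow> real) \<Rightarrow> nat \<Rightarrow> 'd ext_phase \<Rightarrow> real"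
where
  "aug_H H \<gamma> r = (\<lambda>(X, U, Y, V).
     H r (X, V) + H r (U, Y) + \<gamma> r * (norm (X - U))\<^sup>2 + \<gamma> r * (norm (Y - V))\<^sup>2)"

text \<open>A one-step method for stochastic Hamiltonian systems on the extended phase space computes, from
  the Hamiltonians, the step size and the increments of the drivers during the step, a map of the
  phase space. No order of consistency is built in.\<close>

type_synonym 'd one_step_method =
  "(nat \<Rightarrow> 'd ext_phase \<Rightarrow> real) \<Rightarrow> real \<Rightarrow> (nat \<Rightarrow> real \<Rightarrow> real) \<Rightarrow> 'd ext_phase \<Rightarrow> 'd ext_phase"

text \<open>The one-step map with step size \<open>h\<close>, started at time \<open>s\<close>, of the method \<open>\<Phi>\<close> applied to the
  extended system.\<close>

definition ext_step ::
  "'d::finite one_step_method \<Rightarrow> nat \<Rightarrow> (nat \<Rightarrow> 'd phase \<Rightarrow> real) \<Rightarrow> (nat \<Rightarrow> real) \<Rightarrow>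
   (nat \<Rightarrow> real \<Rightarrow> 'w \<Rightarrow> real) \<Rightarrow> real \<Rightarrow> real \<Rightarrow> 'w \<Rightarrow> 'd ext_phase \<Rightarrow> 'd ext_phase"
where
  "ext_step \<Phi> m H \<gamma> W s h \<omega> = \<Phi> (\<lambda>r\<in>{0..m}. aug_H H \<gamma> r) h (step_noise m W s h \<omega>)"


section \<open>Symmetric projection\<close>

definition A_map :: "'d::finite ext_phase \<Rightarrow> 'd phase" where
  "A_map = (\<lambda>(X, U, Y, V). (X - U, Y - V))"

abbreviation At_map :: "'d::finite phase \<Rightarrow> 'd ext_phase" where
  "At_map \<equiv> adjoint A_map"

lemma At_map_eq: "At_map (l, k) = (l, - l, k, - k)"
proof -
  have "At_map = (\<lambda>(l, k). (l, - l, k, - k) :: 'a ext_phase)"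
    by (rule adjoint_unique)
       (auto simp: A_map_def inner_prod_def inner_diff_left inner_diff_right)
  then show ?thesis by simp
qed

definition ker_A :: "'d::finite ext_phase set" where
  "ker_A = {\<xi>. A_map \<xi> = 0}"

definition diag :: "'d::finite phase \<Rightarrow> 'd ext_phase" where
  "diag = (\<lambda>(X, Y). (X, X, Y, Y))"

definition proj_step ::
  "('d::finite ext_phase \<Rightarrow> 'd ext_phase) \<Rightarrow> 'd phase \<Rightarrow> 'd phase \<Rightarrow> 'd ext_phase"
where
  "proj_step F l z = F (diag z + At_map l) + At_map l"

text \<open>\<open>\<Lambda>\<close> is the local solution near \<open>0\<close> of the equation for the multiplier, as a smooth function of
  the current value \<open>(X\<^sup>n, Y\<^sup>n) \<in> D\<close>.\<close>

definition local_multiplier ::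
  "('d::finite ext_phase \<Rightarrow> 'd ext_phase) \<Rightarrow> 'd phase set \<Rightarrow> ('d phase \<Rightarrow> 'd phase) \<Rightarrow> bool"
where
  "local_multiplier F D \<Lambda> \<longleftrightarrow>
     open D \<and> smooth_on D \<Lambda> \<and>
     (\<exists>\<epsilon>>0. \<forall>z\<in>D. norm (\<Lambda> z) < \<epsilon> \<and> proj_step F (\<Lambda> z) z \<in> ker_A \<and>
        (\<forall>l. norm l < \<epsilon> \<and> proj_step F l z \<in> ker_A \<longrightarrow> l = \<Lambda> z))"

text \<open>On \<open>ker_A\<close> the components \<open>X\<close> and \<open>U\<close>, and \<open>Y\<close> and \<open>V\<close>, agree.\<close>

definition semi_explicit ::
  "('d::finite ext_phase \<Rightarrow> 'd ext_phase) \<Rightarrow> ('d phase \<Rightarrow> 'd phase) \<Rightarrow> 'd phase \<Rightarrow> 'd phase"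
where
  "semi_explicit F \<Lambda> z = (case proj_step F (\<Lambda> z) z of (X, U, Y, V) \<Rightarrow> (X, Y))"

text \<open>\<open>(X\<^sup>n, Y\<^sup>n)\<close> as a function of the initial value, where \<open>G n\<close> is the one-step map of step \<open>n\<close>.\<close>

primrec iterates :: "(nat \<Rightarrow> 'a \<Rightarrow> 'a) \<Rightarrow> nat \<Rightarrow> 'a \<Rightarrow> 'a" where
  "iterates G 0 z = z"
| "iterates G (Suc n) z = G n (iterates G n z)"

end

theory Submission imports Defs begin

text \<open>Let \<open>\<Omega>\<close> and \<open>\<omega>\<close> be the symplectic forms on the extended and on the original phase space.
  The diagonal \<open>ker A\<close> and the range of \<open>A\<^sup>T\<close> are \<open>\<Omega>\<close>-orthogonal, and \<open>\<Omega>\<close> restricts to \<open>2\<omega>\<close> on each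
  of them. The derivative of \<open>\<xi>\<^sup>n + A\<^sup>T\<lambda>\<close> is \<open>a \<mapsto> diag a + A\<^sup>T(\<lambda>' a)\<close>, while that of
  \<open>F(\<xi>\<^sup>n + A\<^sup>T\<lambda>) = \<xi>\<^sup>n\<^sup>+\<^sup>1 - A\<^sup>T\<lambda>\<close> is \<open>a \<mapsto> diag (G' a) - A\<^sup>T(\<lambda>' a)\<close>. Pulling back \<open>\<Omega>\<close> along either
  map adds the same term \<open>2\<omega>(\<lambda>' a, \<lambda>' b)\<close>, so that symplecticity of \<open>F\<close> becomes
  \<open>2\<omega>(G' a, G' b) = 2\<omega>(a, b)\<close>.\<close>

definition symp_form :: "'d::finite phase \<Rightarrow> 'd phase \<Rightarrow> real" where
  "symp_form a b = fst a \<bullet> snd b - fst b \<bullet> snd a"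

definition ext_symp_form :: "'d::finite ext_phase \<Rightarrow> 'd ext_phase \<Rightarrow> real" where
  "ext_symp_form = (\<lambda>(X, U, Y, V) (X', U', Y', V'). X \<bullet> Y' - X' \<bullet> Y + (U \<bullet> V' - U' \<bullet> V))"

text \<open>The blocks \<open>X\<close>, \<open>Y\<close> and \<open>U\<close>, \<open>V\<close>
  contribute equally to the pure terms, while each mixed term occurs in them with opposite signs and
  cancels.\<close>

lemma ext_symp_form_diag_plus_At:
  "ext_symp_form (diag a + At_map l) (diag b + At_map k) = 2 * symp_form a b + 2 * symp_form l k"
  by (cases a; cases b; cases l; cases k)
     (simp add: At_map_eq diag_def ext_symp_form_def symp_form_def inner_simps)

lemma At_map_uminus: "At_map (- l) = - At_map l"
  by (cases l) (simp add: At_map_eq)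

text \<open>Differentials of the components are components of the derivative. This turns identities
  between 2-forms into algebra with linear maps.\<close>

lemma dwedge_has_derivative:
  fixes u v :: "'a::real_normed_vector \<Rightarrow> real^'d"
  assumes "(u has_derivative u') (at z)" "(v has_derivative v') (at z)"
  shows "dwedge u v z a b = u' a \<bullet> v' b - u' b \<bullet> v' a"
proof -
  have ext_d: "ext_d (\<lambda>x. w x $ i) z = (\<lambda>c. w' c $ i)"
    if "(w has_derivative w') (at z)" for w w' and i :: 'd
    unfolding ext_d_def
    using frechet_derivative_at[OF bounded_linear.has_derivative[OF bounded_linear_vec_nth that]]
    by simp
  show ?thesis
    unfolding dwedge_def wedge_def ext_d[OF assms(1)] ext_d[OF assms(2)]
    by (simp add: inner_vec_def sum_subtractf)
qed

lemma sform_has_derivative: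
  assumes "(f has_derivative f') (at z)"
  shows "sform f z a b = symp_form (f' a) (f' b)"
  unfolding sform_def symp_form_def
  by (rule dwedge_has_derivative) (auto intro!: derivative_eq_intros assms)

lemma ext_sform_has_derivative:
  assumes "(f has_derivative f') (at z)"
  shows "ext_sform f z a b = ext_symp_form (f' a) (f' b)"
proof -
  have "((\<lambda>x. fst (f x)) has_derivative (\<lambda>a. fst (f' a))) (at z)"
    "((\<lambda>x. fst (snd (f x))) has_derivative (\<lambda>a. fst (snd (f' a)))) (at z)"
    "((\<lambda>x. fst (snd (snd (f x)))) has_derivative (\<lambda>a. fst (snd (snd (f' a))))) (at z)"
    "((\<lambda>x. snd (snd (snd (f x)))) has_derivative (\<lambda>a. snd (snd (snd (f' a))))) (at z)"
    by (auto intro!: derivative_eq_intros assms)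
  note D = this
  show ?thesis
    unfolding ext_sform_def ext_symp_form_def case_prod_unfold
    by (simp add: dwedge_has_derivative[OF D(1) D(3)] dwedge_has_derivative[OF D(2) D(4)])
qed

lemma smooth_on_imp_differentiable: "smooth_on S f \<Longrightarrow> z \<in> S \<Longrightarrow> f differentiable (at z)"
  unfolding smooth_on_def using k_times_differentiable_on.simps(2)[of 0 S f] by blast

lemma bounded_linear_diag: "bounded_linear (diag :: 'd::finite phase \<Rightarrow> 'd ext_phase)"
  by (intro linear_conv_bounded_linear[THEN iffD1] linearI)
     (auto simp: diag_def split: prod.splits)

lemma bounded_linear_At_map: "bounded_linear (At_map :: 'd::finite phase \<Rightarrow> 'd ext_phase)"
  by (intro linear_conv_bounded_linear[THEN iffD1] linearI)
     (auto simp: At_map_eq split: prod.splits)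

lemma proj_step_eq_diag_semi_explicit:
  assumes "proj_step F (\<Lambda> z) z \<in> ker_A"
  shows "proj_step F (\<Lambda> z) z = diag (semi_explicit F \<Lambda> z)"
  using assms
  by (auto simp: ker_A_def A_map_def semi_explicit_def diag_def zero_prod_def
      split: prod.splits)

text \<open>The conclusion is phrased through a derivative \<open>G'\<close> so that the chain rule
  can later combine it with the derivative of the preceding iterates.\<close>

lemma semi_explicit_symplectic:
  fixes F :: "'d::finite ext_phase \<Rightarrow> 'd ext_phase"
  assumes F: "smooth_on UNIV F" and \<Lambda>: "local_multiplier F D \<Lambda>" and z: "z \<in> D"
    and symplectic: "\<And>\<xi>. ext_sform F \<xi> = ext_sform (\<lambda>\<xi>. \<xi>) \<xi>"
  obtains G' where "(semi_explicit F \<Lambda> has_derivative G') (at z)"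
    "\<And>a b. symp_form (G' a) (G' b) = symp_form a b"
proof -
  define \<xi> where "\<xi> x = diag x + At_map (\<Lambda> x)" for x
  define S where "S x = proj_step F (\<Lambda> x) x" for x
  have S_eq: "S = (\<lambda>x. F (\<xi> x) + At_map (\<Lambda> x))"
    by (simp add: S_def \<xi>_def proj_step_def fun_eq_iff)
  have D: "open D" "\<Lambda> differentiable (at z)"
    using \<Lambda> z smooth_on_imp_differentiable by (auto simp: local_multiplier_def)
  have S_diag: "S x = diag (semi_explicit F \<Lambda> x)" if "x \<in> D" for x
    using \<Lambda> that unfolding S_def local_multiplier_def
    by (intro proj_step_eq_diag_semi_explicit) blast
  obtain L where L: "(\<Lambda> has_derivative L) (at z)"
    using D(2) by (auto simp: differentiable_def)
  obtain K where K: "(F has_derivative K) (at (\<xi> z))"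
    using smooth_on_imp_differentiable[OF F UNIV_I] unfolding differentiable_def by blast
  have At': "((\<lambda>x. At_map (\<Lambda> x)) has_derivative (\<lambda>a. At_map (L a))) (at z)"
    by (rule bounded_linear.has_derivative[OF bounded_linear_At_map L])
  have \<xi>': "(\<xi> has_derivative (\<lambda>a. diag a + At_map (L a))) (at z)"
    unfolding \<xi>_def
    by (intro has_derivative_add At' bounded_linear_imp_has_derivative bounded_linear_diag)
  \<comment> \<open>The derivative of \<open>S\<close> is computed twice: here from the projection
    formula by the chain rule, below from the fact that \<open>S\<close> takes values in the
    diagonal.\<close>
  define Q where "Q a = K (diag a + At_map (L a)) + At_map (L a)" for a
  have S': "(S has_derivative Q) (at z)"
    unfolding S_eq Q_def
    by (intro has_derivative_add At' has_derivative_compose[OF \<xi>' K])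
  define G' where "G' a = (fst (Q a), fst (snd (snd (Q a))))" for a
  have G: "(semi_explicit F \<Lambda> has_derivative G') (at z)"
  proof -
    have "semi_explicit F \<Lambda> = (\<lambda>x. (fst (S x), fst (snd (snd (S x)))))"
      by (simp add: semi_explicit_def S_def fun_eq_iff case_prod_unfold)
    then show ?thesis
      unfolding G'_def by (auto intro!: derivative_eq_intros S')
  qed
  \<comment> \<open>\<open>S\<close> is known to be diagonal only on \<open>D\<close>; as
    \<open>D\<close> is open, this determines the derivative at \<open>z\<close>.\<close>
  have "(S has_derivative (\<lambda>a. diag (G' a))) (at z)"
    by (rule has_derivative_transform_within_open
          [OF bounded_linear.has_derivative[OF bounded_linear_diag G] D(1) z])
       (simp add: S_diag)
  with S' have "Q = (\<lambda>a. diag (G' a))"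
    by (rule has_derivative_unique)
  then have "Q a = diag (G' a)" for a
    by (rule fun_cong)
  \<comment> \<open>Solving for \<open>K\<close> moves the multiplier term across. Its sign flips,
    which a bilinear form does not see when both arguments flip.\<close>
  then have K_eq: "K (diag a + At_map (L a)) = diag (G' a) + At_map (- L a)" for a
    by (simp add: Q_def At_map_uminus eq_diff_eq)
  have "symp_form (G' a) (G' b) = symp_form a b" for a b
  proof -
    have "ext_symp_form (K v) (K w) = ext_symp_form v w" for v w
      unfolding ext_sform_has_derivative[OF K, symmetric] symplectic
      by (rule ext_sform_has_derivative[OF has_derivative_ident])
    \<comment> \<open>Both sides split into a diagonal and a multiplier part; the multiplier parts
      agree and the factor 2 cancels.\<close>
    from this[of "diag a + At_map (L a)" "diag b + At_map (L b)"] show ?thesis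
      unfolding K_eq ext_symp_form_diag_plus_At by (simp add: symp_form_def)
  qed
  with G show thesis by (rule that)
qed

lemma iterates_differentiable:
  assumes "\<And>k. k < n \<Longrightarrow> G k differentiable (at (iterates G k z))"
  shows "iterates G n differentiable (at z)"
  using assms
proof (induction n)
  case 0
  then show ?case by simp
next
  case (Suc n)
  then have "(G n \<circ> iterates G n) differentiable (at z)"
    by (intro differentiable_chain_at) auto
  then show ?case by (simp add: o_def)
qed

theorem theorem2p1:
  fixes M :: "'w measure" and W :: "nat \<Rightarrow> real \<Rightarrow> 'w \<Rightarrow> real"
    and m N :: nat and T dt :: real
    and H :: "nat \<Rightarrow> 'd::finite phase \<Rightarrow> real" and \<gamma> :: "nat \<Rightarrow> real"
    and \<Phi> :: "'d one_step_method"
    and F :: "real \<Rightarrow> nat \<Rightarrow> 'w \<Rightarrow> 'd ext_phase \<Rightarrow> 'd ext_phase"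
    and D :: "nat \<Rightarrow> 'w \<Rightarrow> 'd phase set"
    and \<Lambda> :: "nat \<Rightarrow> 'w \<Rightarrow> 'd phase \<Rightarrow> 'd phase"
    and G :: "'w \<Rightarrow> nat \<Rightarrow> 'd phase \<Rightarrow> 'd phase"
  assumes prob: "prob_space M"
    and wiener: "independent_wieners M m W"
    and H_smooth: "\<And>r. r \<le> m \<Longrightarrow> smooth_on UNIV (H r)"
    and grid: "T > 0" "N > 0" "dt = T / real N"
    and F_eq: "\<And>h n \<omega>. F h n \<omega> = ext_step \<Phi> m H \<gamma> W (real n * dt) h \<omega>"
    and F_smooth: "\<And>n \<omega>. n < N \<Longrightarrow> \<omega> \<in> space M \<Longrightarrow> smooth_on UNIV (F dt n \<omega>)"
    and F_zero: "\<And>n \<omega>. n < N \<Longrightarrow> \<omega> \<in> space M \<Longrightarrow> F 0 n \<omega> = id"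
    and multiplier:
      "\<And>n \<omega>. n < N \<Longrightarrow> \<omega> \<in> space M \<Longrightarrow> local_multiplier (F dt n \<omega>) (D n \<omega>) (\<Lambda> n \<omega>)"
    and G_eq: "\<And>n \<omega>. G \<omega> n = semi_explicit (F dt n \<omega>) (\<Lambda> n \<omega>)"
    and symplectic:
      "AE \<omega> in M. \<forall>n<N. \<forall>\<xi>. ext_sform (F dt n \<omega>) \<xi> = ext_sform (\<lambda>\<xi>. \<xi>) \<xi>"
  shows "AE \<omega> in M. \<forall>n<N.
      (\<forall>z\<in>D n \<omega>. sform (G \<omega> n) z = sform (\<lambda>z. z) z) \<and>
      (\<forall>z\<^sub>0. (\<forall>k\<le>n. iterates (G \<omega>) k z\<^sub>0 \<in> D k \<omega>) \<longrightarrow>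
         sform (iterates (G \<omega>) (Suc n)) z\<^sub>0 = sform (iterates (G \<omega>) n) z\<^sub>0)"
  \<comment> \<open>\<open>AE_space\<close> provides \<open>\<omega> \<in> space M\<close>, under
    which smoothness and the multiplier are given. From here on the noise is fixed.\<close>
  using symplectic AE_space
proof eventually_elim
  case (elim \<omega>)
  have step: "\<exists>G'. (G \<omega> k has_derivative G') (at z) \<and>
      (\<forall>a b. symp_form (G' a) (G' b) = symp_form a b)" if "k < N" "z \<in> D k \<omega>" for k z
  proof -
    have "smooth_on UNIV (F dt k \<omega>)" "local_multiplier (F dt k \<omega>) (D k \<omega>) (\<Lambda> k \<omega>)"
      "\<And>\<xi>. ext_sform (F dt k \<omega>) \<xi> = ext_sform (\<lambda>\<xi>. \<xi>) \<xi>"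
      using F_smooth multiplier elim \<open>k < N\<close> by auto
    from this(1,2) \<open>z \<in> D k \<omega>\<close> this(3) show ?thesis
      unfolding G_eq by (rule semi_explicit_symplectic) blast
  qed
  have "sform (G \<omega> n) z = sform (\<lambda>z. z) z" if "n < N" "z \<in> D n \<omega>" for n z
  proof -
    obtain G' where G': "(G \<omega> n has_derivative G') (at z)"
      "\<And>a b. symp_form (G' a) (G' b) = symp_form a b"
      using step[OF \<open>n < N\<close> \<open>z \<in> D n \<omega>\<close>] by blast
    show ?thesis
      by (intro ext)
         (simp add: sform_has_derivative[OF G'(1)]
           sform_has_derivative[OF has_derivative_ident] G'(2))
  qed
  moreover have "sform (iterates (G \<omega>) (Suc n)) z = sform (iterates (G \<omega>) n) z"
    if n: "n < N" "\<forall>k\<le>n. iterates (G \<omega>) k z \<in> D k \<omega>" for n z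
  proof -
    \<comment> \<open>The orbit points with index below \<open>n\<close> give differentiability of
      the iterate; the point with index \<open>n\<close> serves for the last step.\<close>
    have "iterates (G \<omega>) n differentiable (at z)"
    proof (rule iterates_differentiable)
      fix k assume "k < n"
      then show "G \<omega> k differentiable (at (iterates (G \<omega>) k z))"
        using step[of k "iterates (G \<omega>) k z"] n by (auto simp: differentiable_def)
    qed
    then obtain I' where I': "(iterates (G \<omega>) n has_derivative I') (at z)"
      by (auto simp: differentiable_def)
    obtain G' where G': "(G \<omega> n has_derivative G') (at (iterates (G \<omega>) n z))"
      "\<And>a b. symp_form (G' a) (G' b) = symp_form a b"
      using step[of n "iterates (G \<omega>) n z"] n by blast
    have "iterates (G \<omega>) (Suc n) = (\<lambda>x. G \<omega> n (iterates (G \<omega>) n x))"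
      by (simp add: fun_eq_iff)
    \<comment> \<open>Since \<open>G'\<close> preserves \<open>symp_form\<close>, \<open>I'\<close>
      followed by \<open>G'\<close> pulls it back to the same form as \<open>I'\<close>
      alone.\<close>
    then have "(iterates (G \<omega>) (Suc n) has_derivative (\<lambda>a. G' (I' a))) (at z)"
      using has_derivative_compose[OF I' G'(1)] by (simp only:)
    then show ?thesis
      by (intro ext) (simp add: sform_has_derivative[OF I'] sform_has_derivative G'(2))
  qed
  ultimately show ?case by blast
qed

end
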